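(* Let $R$ be a nonzero associative ring with identity and let $n\geq 1$ be an integer. An ideal $J$ of the full matrix ring $M_n(R)$ is a $z^{\circ}$-ideal of $M_n(R)$ if and only if $J=M_n(I)$ for some $z_{n^2}^{\circ}$-ideal $I$ of $R$.
   Context: "Ideal" means two-sided ideal. For a subset $A$ of a ring $R$, $P_A$ denotes the intersection of all minimal prime ideals of $R$ containing $A$ (an empty intersection is the whole ring), and $P_a=P_{\{a\}}$. An ideal $I$ of a ring $R$ is a $z^{\circ}$-ideal if $P_a\subseteq I$ for every $a\in I$. For $m\in\mathbb{N}$, an ideal $I$ of $R$ is a $z_m^{\circ}$-ideal if $P_F\subseteq I$ for every finite subset $F$ of $I$ with at most $m$ elements. $M_n(I)$ is the set of $n\times n$ matrices with all entries in $I$. *)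

theory Defs
  imports
    "Jordan_Normal_Form.Matrix"
    "HOL-Algebra.Ideal_Product"
begin

text \<open>
  Rings are not assumed commutative. The locale \<open>ideal\<close> is the two-sided notion, but
  \<open>primeideal\<close> presupposes a commutative ring, so primeness is defined here through products
  of two-sided ideals.
\<close>

definition nc_prime_ideal :: "'a set \<Rightarrow> ('a, 'b) ring_scheme \<Rightarrow> bool" where
  "nc_prime_ideal P R \<longleftrightarrow> ideal P R \<and> P \<noteq> carrier R \<and>
     (\<forall>A B. ideal A R \<and> ideal B R \<and> ideal_prod R A B \<subseteq> P \<longrightarrow> A \<subseteq> P \<or> B \<subseteq> P)"

definition min_prime_ideal :: "'a set \<Rightarrow> ('a, 'b) ring_scheme \<Rightarrow> bool" where
  "min_prime_ideal P R \<longleftrightarrow> nc_prime_ideal P R \<and>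
     (\<forall>Q. nc_prime_ideal Q R \<and> Q \<subseteq> P \<longrightarrow> Q = P)"

text \<open>
  The family consists of the minimal primes of the ring that happen to contain \<open>A\<close>, not of the
  primes minimal over \<open>A\<close>. It may be empty; intersecting with the carrier then gives the whole
  ring.
\<close>

definition min_prime_hull :: "('a, 'b) ring_scheme \<Rightarrow> 'a set \<Rightarrow> 'a set" where
  "min_prime_hull R A = carrier R \<inter> \<Inter>{P. min_prime_ideal P R \<and> A \<subseteq> P}"

definition z_circ_ideal :: "'a set \<Rightarrow> ('a, 'b) ring_scheme \<Rightarrow> bool" where
  "z_circ_ideal I R \<longleftrightarrow> ideal I R \<and> (\<forall>a\<in>I. min_prime_hull R {a} \<subseteq> I)"

definition zm_circ_ideal :: "nat \<Rightarrow> 'a set \<Rightarrow> ('a, 'b) ring_scheme \<Rightarrow> bool" where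
  "zm_circ_ideal m I R \<longleftrightarrow> ideal I R \<and>
     (\<forall>F. finite F \<and> F \<subseteq> I \<and> card F \<le> m \<longrightarrow> min_prime_hull R F \<subseteq> I)"

definition matrices_over :: "nat \<Rightarrow> 'a set \<Rightarrow> 'a mat set" where
  "matrices_over n I = {A \<in> carrier_mat n n. \<forall>i<n. \<forall>j<n. A $$ (i, j) \<in> I}"

text \<open>
  \<open>ring_mat\<close> takes its entries from a type class; here they come from an arbitrary ring with a
  carrier set.
\<close>

definition matrix_ring :: "nat \<Rightarrow> ('a, 'b) ring_scheme \<Rightarrow> 'a mat ring" where
  "matrix_ring n R = \<lparr>
     carrier = matrices_over n (carrier R),
     mult = (\<lambda>A B. mat n n (\<lambda>(i, j). \<Oplus>\<^bsub>R\<^esub>k\<in>{..<n}. A $$ (i, k) \<otimes>\<^bsub>R\<^esub> B $$ (k, j))),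
     one = mat n n (\<lambda>(i, j). if i = j then \<one>\<^bsub>R\<^esub> else \<zero>\<^bsub>R\<^esub>),
     zero = mat n n (\<lambda>(i, j). \<zero>\<^bsub>R\<^esub>),
     add = (\<lambda>A B. mat n n (\<lambda>(i, j). A $$ (i, j) \<oplus>\<^bsub>R\<^esub> B $$ (i, j)))\<rparr>"

lemma (in ring) finsum_swap:
  assumes "finite A" "finite B" "\<And>x y. x \<in> A \<Longrightarrow> y \<in> B \<Longrightarrow> f x y \<in> carrier R"
  shows "(\<Oplus>x\<in>A. \<Oplus>y\<in>B. f x y) = (\<Oplus>y\<in>B. \<Oplus>x\<in>A. f x y)"
  using assms(1,3)
proof (induction A rule: finite_induct)
  case empty
  then show ?case by simp
next
  case (insert a A)
  have "(\<Oplus>x\<in>insert a A. \<Oplus>y\<in>B. f x y) = (\<Oplus>y\<in>B. f a y) \<oplus> (\<Oplus>x\<in>A. \<Oplus>y\<in>B. f x y)"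
    using insert by (intro finsum_insert) (auto intro!: finsum_closed)
  also have "\<dots> = (\<Oplus>y\<in>B. f a y) \<oplus> (\<Oplus>y\<in>B. \<Oplus>x\<in>A. f x y)"
    using insert by simp
  also have "\<dots> = (\<Oplus>y\<in>B. f a y \<oplus> (\<Oplus>x\<in>A. f x y))"
    using insert by (intro finsum_addf[symmetric]) (auto intro!: finsum_closed)
  also have "\<dots> = (\<Oplus>y\<in>B. \<Oplus>x\<in>insert a A. f x y)"
    using insert by (intro finsum_cong' finsum_insert[symmetric]) (auto intro!: finsum_closed)
  finally show ?case .
qed

lemma (in ring) finsum_delta_left:
  assumes "i < (n::nat)" "\<And>k. k < n \<Longrightarrow> f k \<in> carrier R"
  shows "(\<Oplus>k\<in>{..<n}. (if i = k then \<one> else \<zero>) \<otimes> f k) = f i"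
proof -
  have "(\<Oplus>k\<in>{..<n}. (if i = k then \<one> else \<zero>) \<otimes> f k) = (\<Oplus>k\<in>{..<n}. if i = k then f k else \<zero>)"
    using assms by (intro finsum_cong') auto
  also have "\<dots> = f i"
    using assms by (intro add.finprod_singleton) auto
  finally show ?thesis .
qed

lemma (in ring) finsum_delta_right:
  assumes "j < (n::nat)" "\<And>k. k < n \<Longrightarrow> f k \<in> carrier R"
  shows "(\<Oplus>k\<in>{..<n}. f k \<otimes> (if k = j then \<one> else \<zero>)) = f j"
proof -
  have "(\<Oplus>k\<in>{..<n}. f k \<otimes> (if k = j then \<one> else \<zero>)) = (\<Oplus>k\<in>{..<n}. if j = k then f k else \<zero>)"
    using assms by (intro finsum_cong') auto
  also have "\<dots> = f j"
    using assms by (intro add.finprod_singleton) auto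
  finally show ?thesis .
qed

lemma (in ring) ring_matrix_ring: "ring (matrix_ring n R)"
proof (rule ringI)
  let ?M = "matrix_ring n R"
  show "abelian_group ?M"
  proof (rule abelian_groupI)
    fix x assume x: "x \<in> carrier ?M"
    show "\<exists>y\<in>carrier ?M. y \<oplus>\<^bsub>?M\<^esub> x = \<zero>\<^bsub>?M\<^esub>"
      by (rule bexI[of _ "mat n n (\<lambda>(i, j). \<ominus> x $$ (i, j))"])
        (use x in \<open>auto simp: matrix_ring_def matrices_over_def l_neg intro!: eq_matI\<close>)
  qed (auto simp: matrix_ring_def matrices_over_def a_ac intro!: eq_matI)
  show "Group.monoid ?M"
  proof (rule monoidI)
    fix x y z assume xyz: "x \<in> carrier ?M" "y \<in> carrier ?M" "z \<in> carrier ?M"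
    have x: "x $$ (i, j) \<in> carrier R" if "i < n" "j < n" for i j
      using xyz that by (auto simp: matrix_ring_def matrices_over_def)
    have y: "y $$ (i, j) \<in> carrier R" if "i < n" "j < n" for i j
      using xyz that by (auto simp: matrix_ring_def matrices_over_def)
    have z: "z $$ (i, j) \<in> carrier R" if "i < n" "j < n" for i j
      using xyz that by (auto simp: matrix_ring_def matrices_over_def)
    have "(\<Oplus>k\<in>{..<n}. (\<Oplus>l\<in>{..<n}. x $$ (i, l) \<otimes> y $$ (l, k)) \<otimes> z $$ (k, j)) =
          (\<Oplus>l\<in>{..<n}. x $$ (i, l) \<otimes> (\<Oplus>k\<in>{..<n}. y $$ (l, k) \<otimes> z $$ (k, j)))"
      if ij: "i < n" "j < n" for i j
    proof -
      have "(\<Oplus>k\<in>{..<n}. (\<Oplus>l\<in>{..<n}. x $$ (i, l) \<otimes> y $$ (l, k)) \<otimes> z $$ (k, j)) =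
            (\<Oplus>k\<in>{..<n}. \<Oplus>l\<in>{..<n}. x $$ (i, l) \<otimes> y $$ (l, k) \<otimes> z $$ (k, j))"
        using x y z ij by (intro finsum_cong' finsum_ldistr) (auto intro!: finsum_closed)
      also have "\<dots> = (\<Oplus>l\<in>{..<n}. \<Oplus>k\<in>{..<n}. x $$ (i, l) \<otimes> y $$ (l, k) \<otimes> z $$ (k, j))"
        using x y z ij by (intro finsum_swap) auto
      also have "\<dots> = (\<Oplus>l\<in>{..<n}. \<Oplus>k\<in>{..<n}. x $$ (i, l) \<otimes> (y $$ (l, k) \<otimes> z $$ (k, j)))"
        using x y z ij by (intro finsum_cong') (auto intro!: finsum_closed finsum_cong' simp: m_assoc)
      also have "\<dots> = (\<Oplus>l\<in>{..<n}. x $$ (i, l) \<otimes> (\<Oplus>k\<in>{..<n}. y $$ (l, k) \<otimes> z $$ (k, j)))"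
        using x y z ij by (intro finsum_cong' finsum_rdistr[symmetric]) (auto intro!: finsum_closed)
      finally show ?thesis .
    qed
    then show "x \<otimes>\<^bsub>?M\<^esub> y \<otimes>\<^bsub>?M\<^esub> z = x \<otimes>\<^bsub>?M\<^esub> (y \<otimes>\<^bsub>?M\<^esub> z)"
      using x y z
      by (auto simp: matrix_ring_def intro!: eq_matI cong: finsum_cong)
  next
    fix x assume x: "x \<in> carrier ?M"
    have e: "x $$ (i, j) \<in> carrier R" if "i < n" "j < n" for i j
      using x that by (auto simp: matrix_ring_def matrices_over_def)
    have d: "dim_row x = n" "dim_col x = n"
      using x by (auto simp: matrix_ring_def matrices_over_def)
    have "(\<Oplus>k\<in>{..<n}. \<one>\<^bsub>?M\<^esub> $$ (i, k) \<otimes> x $$ (k, j)) = x $$ (i, j)" if ij: "i < n" "j < n" for i j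
    proof -
      have "(\<Oplus>k\<in>{..<n}. \<one>\<^bsub>?M\<^esub> $$ (i, k) \<otimes> x $$ (k, j)) =
            (\<Oplus>k\<in>{..<n}. (if i = k then \<one> else \<zero>) \<otimes> x $$ (k, j))"
        using ij e by (intro finsum_cong') (auto simp: matrix_ring_def)
      then show ?thesis
        using finsum_delta_left[OF ij(1), of "\<lambda>k. x $$ (k, j)"] e ij by simp
    qed
    then show "\<one>\<^bsub>?M\<^esub> \<otimes>\<^bsub>?M\<^esub> x = x"
      using d by (intro eq_matI) (auto simp: matrix_ring_def)
    have "(\<Oplus>k\<in>{..<n}. x $$ (i, k) \<otimes> \<one>\<^bsub>?M\<^esub> $$ (k, j)) = x $$ (i, j)" if ij: "i < n" "j < n" for i j
    proof -
      have "(\<Oplus>k\<in>{..<n}. x $$ (i, k) \<otimes> \<one>\<^bsub>?M\<^esub> $$ (k, j)) =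
            (\<Oplus>k\<in>{..<n}. x $$ (i, k) \<otimes> (if k = j then \<one> else \<zero>))"
        using ij e by (intro finsum_cong') (auto simp: matrix_ring_def)
      then show ?thesis
        using finsum_delta_right[OF ij(2), of "\<lambda>k. x $$ (i, k)"] e ij by simp
    qed
    then show "x \<otimes>\<^bsub>?M\<^esub> \<one>\<^bsub>?M\<^esub> = x"
      using d by (intro eq_matI) (auto simp: matrix_ring_def)
  qed (auto simp: matrix_ring_def matrices_over_def intro!: finsum_closed)
  fix x y z assume xyz: "x \<in> carrier ?M" "y \<in> carrier ?M" "z \<in> carrier ?M"
  have e: "x $$ (i, j) \<in> carrier R" "y $$ (i, j) \<in> carrier R" "z $$ (i, j) \<in> carrier R"
    if "i < n" "j < n" for i j
    using xyz that by (auto simp: matrix_ring_def matrices_over_def)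
  have "(\<Oplus>k\<in>{..<n}. (x \<oplus>\<^bsub>?M\<^esub> y) $$ (i, k) \<otimes> z $$ (k, j)) =
        (\<Oplus>k\<in>{..<n}. x $$ (i, k) \<otimes> z $$ (k, j)) \<oplus> (\<Oplus>k\<in>{..<n}. y $$ (i, k) \<otimes> z $$ (k, j))"
    if ij: "i < n" "j < n" for i j
  proof -
    have "(\<Oplus>k\<in>{..<n}. (x \<oplus>\<^bsub>?M\<^esub> y) $$ (i, k) \<otimes> z $$ (k, j)) =
          (\<Oplus>k\<in>{..<n}. x $$ (i, k) \<otimes> z $$ (k, j) \<oplus> y $$ (i, k) \<otimes> z $$ (k, j))"
      using ij e by (intro finsum_cong') (auto simp: matrix_ring_def l_distr)
    then show ?thesis
      using ij e by (simp add: finsum_addf)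
  qed
  then show "(x \<oplus>\<^bsub>?M\<^esub> y) \<otimes>\<^bsub>?M\<^esub> z = x \<otimes>\<^bsub>?M\<^esub> z \<oplus>\<^bsub>?M\<^esub> y \<otimes>\<^bsub>?M\<^esub> z"
    by (intro eq_matI) (auto simp: matrix_ring_def)
  have "(\<Oplus>k\<in>{..<n}. z $$ (i, k) \<otimes> (x \<oplus>\<^bsub>?M\<^esub> y) $$ (k, j)) =
        (\<Oplus>k\<in>{..<n}. z $$ (i, k) \<otimes> x $$ (k, j)) \<oplus> (\<Oplus>k\<in>{..<n}. z $$ (i, k) \<otimes> y $$ (k, j))"
    if ij: "i < n" "j < n" for i j
  proof -
    have "(\<Oplus>k\<in>{..<n}. z $$ (i, k) \<otimes> (x \<oplus>\<^bsub>?M\<^esub> y) $$ (k, j)) =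
          (\<Oplus>k\<in>{..<n}. z $$ (i, k) \<otimes> x $$ (k, j) \<oplus> z $$ (i, k) \<otimes> y $$ (k, j))"
      using ij e by (intro finsum_cong') (auto simp: matrix_ring_def r_distr)
    then show ?thesis
      using ij e by (simp add: finsum_addf)
  qed
  then show "z \<otimes>\<^bsub>?M\<^esub> (x \<oplus>\<^bsub>?M\<^esub> y) = z \<otimes>\<^bsub>?M\<^esub> x \<oplus>\<^bsub>?M\<^esub> z \<otimes>\<^bsub>?M\<^esub> y"
    by (intro eq_matI) (auto simp: matrix_ring_def)
qed

end

theory Submission
  imports Defs
begin

text \<open>
  By multiplying with matrix units, every ideal of the matrix ring over \<open>R\<close> is \<open>matrices_over n I\<close>
  for an ideal \<open>I\<close> of \<open>R\<close>. This correspondence preserves inclusions and products, hence (minimal)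
  primes, so the hull of \<open>{A}\<close> consists of the matrices over the hull of the set of entries of \<open>A\<close>.
  Such sets of entries are cofinal among the subsets with at most \<open>n\<^sup>2\<close> elements.
\<close>

section \<open>Sets of matrices with entries in a given set\<close>

lemma mem_matrices_over_iff:
  "A \<in> matrices_over n I \<longleftrightarrow> A \<in> carrier_mat n n \<and> (\<forall>i<n. \<forall>j<n. A $$ (i, j) \<in> I)"
  by (simp add: matrices_over_def)

lemma mat_mem_matrices_over_iff:
  "mat n n f \<in> matrices_over n I \<longleftrightarrow> (\<forall>i<n. \<forall>j<n. f (i, j) \<in> I)"
  by (simp add: matrices_over_def)

text \<open>The constant matrix with value \<open>a\<close> tests whether \<open>a\<close> lies in
  the set of entries. This takes at least one position: for \<open>n = 0\<close> the inclusion
  between the matrix sets always holds.\<close>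

lemma matrices_over_subset_iff:
  assumes "n \<ge> 1"
  shows "matrices_over n I \<subseteq> matrices_over n K \<longleftrightarrow> I \<subseteq> K"
proof
  assume sub: "matrices_over n I \<subseteq> matrices_over n K"
  show "I \<subseteq> K"
  proof
    fix a assume "a \<in> I"
    then have "mat n n (\<lambda>_. a) \<in> matrices_over n I"
      by (simp add: mat_mem_matrices_over_iff)
    with sub have "mat n n (\<lambda>_. a) \<in> matrices_over n K" by blast
    then show "a \<in> K"
      using assms unfolding mat_mem_matrices_over_iff by (metis One_nat_def Suc_le_lessD)
  qed
qed (auto simp: matrices_over_def)

lemma matrices_over_eq_iff:
  "n \<ge> 1 \<Longrightarrow> matrices_over n I = matrices_over n K \<longleftrightarrow> I = K"
  by (metis matrices_over_subset_iff subset_antisym subset_refl)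

lemma carrier_matrix_ring: "carrier (matrix_ring n R) = matrices_over n (carrier R)"
  by (simp add: matrix_ring_def)

text \<open>\<open>ideal_prod\<close> consists of finite sums of products and \<open>P\<close> is
  closed under addition. Primeness can thus be tested on products of elements, which are computable
  in the matrix ring.\<close>

lemma (in ring) ideal_prod_subset_iff:
  assumes "ideal P R"
  shows "ideal_prod R A B \<subseteq> P \<longleftrightarrow> (\<forall>a\<in>A. \<forall>b\<in>B. a \<otimes> b \<in> P)"
proof
  assume *: "\<forall>a\<in>A. \<forall>b\<in>B. a \<otimes> b \<in> P"
  show "ideal_prod R A B \<subseteq> P"
  proof
    fix x assume "x \<in> ideal_prod R A B"
    then show "x \<in> P"
    proof (induction rule: ideal_prod.induct)
      case (sum s1 s2)
      then show ?case
        using additive_subgroup.a_closed[OF ideal.axioms(1)[OF assms]] by blast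
    qed (use * in blast)
  qed
qed (auto intro: ideal_prod.prod)

section \<open>Scaled matrix units and multiplication by them\<close>

definition unit_mat :: "('a, 'b) ring_scheme \<Rightarrow> nat \<Rightarrow> nat \<Rightarrow> nat \<Rightarrow> 'a \<Rightarrow> 'a mat" where
  "unit_mat R n p q a = mat n n (\<lambda>(i, j). if i = p \<and> j = q then a else \<zero>\<^bsub>R\<^esub>)"

context ring
begin

lemma unit_mat_mem_matrices_over:
  "a \<in> I \<Longrightarrow> \<zero> \<in> I \<Longrightarrow> unit_mat R n p q a \<in> matrices_over n I"
  by (simp add: unit_mat_def mat_mem_matrices_over_iff)

text \<open>Only the summand with \<open>k = q\<close> survives, so row \<open>q\<close> of
  \<open>A\<close> is scaled from the left and moved to row \<open>p\<close>; all other rows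
  vanish.\<close>

lemma unit_mat_mult:
  assumes "A \<in> matrices_over n (carrier R)" "x \<in> carrier R" "q < n"
  shows "unit_mat R n p q x \<otimes>\<^bsub>matrix_ring n R\<^esub> A =
    mat n n (\<lambda>(i, j). if i = p then x \<otimes> A $$ (q, j) else \<zero>)"
proof (rule eq_matI)
  fix i j assume ij: "i < dim_row (mat n n (\<lambda>(i, j). if i = p then x \<otimes> A $$ (q, j) else \<zero>))"
    "j < dim_col (mat n n (\<lambda>(i, j). if i = p then x \<otimes> A $$ (q, j) else \<zero>))"
  have e: "\<And>i j. i < n \<Longrightarrow> j < n \<Longrightarrow> A $$ (i, j) \<in> carrier R"
    using assms by (simp add: mem_matrices_over_iff)
  \<comment> \<open>The test on \<open>k\<close> is made the outermost one, which is the shape that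
    \<open>add.finprod_singleton\<close> evaluates.\<close>
  have "(\<Oplus>k\<in>{..<n}. unit_mat R n p q x $$ (i, k) \<otimes> A $$ (k, j)) =
      (\<Oplus>k\<in>{..<n}. if q = k then (if i = p then x \<otimes> A $$ (k, j) else \<zero>) else \<zero>)"
    using ij e assms by (intro finsum_cong') (auto simp: unit_mat_def)
  also have "\<dots> = (if i = p then x \<otimes> A $$ (q, j) else \<zero>)"
    using ij e assms by (intro add.finprod_singleton) auto
  finally show "(unit_mat R n p q x \<otimes>\<^bsub>matrix_ring n R\<^esub> A) $$ (i, j) =
      mat n n (\<lambda>(i, j). if i = p then x \<otimes> A $$ (q, j) else \<zero>) $$ (i, j)"
    using ij by (simp add: matrix_ring_def)
qed (simp_all add: matrix_ring_def)

text \<open>The column counterpart: column \<open>p\<close> of \<open>A\<close> is scaled from the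
  right and moved to column \<open>q\<close>.\<close>

lemma mult_unit_mat:
  assumes "A \<in> matrices_over n (carrier R)" "x \<in> carrier R" "p < n"
  shows "A \<otimes>\<^bsub>matrix_ring n R\<^esub> unit_mat R n p q x =
    mat n n (\<lambda>(i, j). if j = q then A $$ (i, p) \<otimes> x else \<zero>)"
proof (rule eq_matI)
  fix i j assume ij: "i < dim_row (mat n n (\<lambda>(i, j). if j = q then A $$ (i, p) \<otimes> x else \<zero>))"
    "j < dim_col (mat n n (\<lambda>(i, j). if j = q then A $$ (i, p) \<otimes> x else \<zero>))"
  have e: "\<And>i j. i < n \<Longrightarrow> j < n \<Longrightarrow> A $$ (i, j) \<in> carrier R"
    using assms by (simp add: mem_matrices_over_iff)
  have "(\<Oplus>k\<in>{..<n}. A $$ (i, k) \<otimes> unit_mat R n p q x $$ (k, j)) =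
      (\<Oplus>k\<in>{..<n}. if p = k then (if j = q then A $$ (i, k) \<otimes> x else \<zero>) else \<zero>)"
    using ij e assms by (intro finsum_cong') (auto simp: unit_mat_def)
  also have "\<dots> = (if j = q then A $$ (i, p) \<otimes> x else \<zero>)"
    using ij e assms by (intro add.finprod_singleton) auto
  finally show "(A \<otimes>\<^bsub>matrix_ring n R\<^esub> unit_mat R n p q x) $$ (i, j) =
      mat n n (\<lambda>(i, j). if j = q then A $$ (i, p) \<otimes> x else \<zero>) $$ (i, j)"
    using ij by (simp add: matrix_ring_def)
qed (simp_all add: matrix_ring_def)

section \<open>Ideals of the matrix ring\<close>

lemma idealI_closed:
  assumes "I \<subseteq> carrier R" "\<zero> \<in> I"
    and "\<And>a b. a \<in> I \<Longrightarrow> b \<in> I \<Longrightarrow> a \<oplus> b \<in> I"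
    and "\<And>a x. a \<in> I \<Longrightarrow> x \<in> carrier R \<Longrightarrow> x \<otimes> a \<in> I"
    and "\<And>a x. a \<in> I \<Longrightarrow> x \<in> carrier R \<Longrightarrow> a \<otimes> x \<in> I"
  shows "ideal I R"
proof (rule idealI[OF ring_axioms])
  show "subgroup I (add_monoid R)"
  proof (rule add.subgroupI)
    fix a assume "a \<in> I"
    \<comment> \<open>Closure under negation comes from multiplication by the negative of the
      identity.\<close>
    moreover have "\<ominus> a = \<ominus> \<one> \<otimes> a"
      using \<open>a \<in> I\<close> assms(1) by (simp add: l_minus subsetD)
    ultimately show "\<ominus> a \<in> I" using assms(4) by simp
  qed (use assms in auto)
qed (use assms in auto)

text \<open>Applied below to the entries of matrix products, whose summands all lie in the
  ideal.\<close>

lemma finsum_mem_ideal: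
  assumes "ideal I R" "finite S" "\<And>k. k \<in> S \<Longrightarrow> f k \<in> I"
  shows "(\<Oplus>k\<in>S. f k) \<in> I"
  using assms(2,3)
proof (induction S rule: finite_induct)
  case empty
  then show ?case
    by (simp add: additive_subgroup.zero_closed[OF ideal.axioms(1)[OF assms(1)]])
next
  case (insert k S)
  have "f \<in> insert k S \<rightarrow> carrier R"
    using insert.prems ideal.Icarr[OF assms(1)] by auto
  then show ?case
    using insert by (simp add: additive_subgroup.a_closed[OF ideal.axioms(1)[OF assms(1)]])
qed

lemma ideal_matrices_over:
  assumes "ideal I R"
  shows "ideal (matrices_over n I) (matrix_ring n R)"
proof -
  interpret I: ideal I R by fact
  interpret M: ring "matrix_ring n R" by (rule ring_matrix_ring)
  show ?thesis
  proof (rule M.idealI_closed)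
    show "matrices_over n I \<subseteq> carrier (matrix_ring n R)"
      using I.Icarr by (auto simp: carrier_matrix_ring mem_matrices_over_iff)
  next
    show "\<zero>\<^bsub>matrix_ring n R\<^esub> \<in> matrices_over n I"
      by (simp add: matrix_ring_def mat_mem_matrices_over_iff)
  next
    fix A B assume "A \<in> matrices_over n I" "B \<in> matrices_over n I"
    then show "A \<oplus>\<^bsub>matrix_ring n R\<^esub> B \<in> matrices_over n I"
      by (simp add: matrix_ring_def mat_mem_matrices_over_iff mem_matrices_over_iff)
  next
    fix A X assume "A \<in> matrices_over n I" "X \<in> carrier (matrix_ring n R)"
    then show "X \<otimes>\<^bsub>matrix_ring n R\<^esub> A \<in> matrices_over n I"
      by (auto simp: matrix_ring_def mat_mem_matrices_over_iff mem_matrices_over_iff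
          intro!: finsum_mem_ideal[OF assms] I.I_l_closed)
  next
    fix A X assume "A \<in> matrices_over n I" "X \<in> carrier (matrix_ring n R)"
    then show "A \<otimes>\<^bsub>matrix_ring n R\<^esub> X \<in> matrices_over n I"
      by (auto simp: matrix_ring_def mat_mem_matrices_over_iff mem_matrices_over_iff
          intro!: finsum_mem_ideal[OF assms] I.I_r_closed)
  qed
qed

text \<open>Matrix units on both sides carry any entry of a member of \<open>J\<close> to any
  position. Hence the entries at one fixed position already form the required ideal, and
  \<open>J\<close> contains every sum of matrix units scaled by its elements.\<close>

lemma ideal_matrix_ringE:
  assumes "ideal J (matrix_ring n R)" "n \<ge> 1"
  obtains I where "ideal I R" "J = matrices_over n I"
proof -
  interpret J: ideal J "matrix_ring n R" by fact
  note J_zero = additive_subgroup.zero_closed[OF J.is_additive_subgroup]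
    and J_add = additive_subgroup.a_closed[OF J.is_additive_subgroup]
  \<comment> \<open>The position \<open>(0, 0)\<close> exists because \<open>n \<ge> 1\<close>; any
    other position would give the same set.\<close>
  define I where "I = (\<lambda>A. A $$ (0, 0)) ` J"
  have JM: "A \<in> matrices_over n (carrier R)" if "A \<in> J" for A
    using J.Icarr[OF that] by (simp add: carrier_matrix_ring)
  have unit_M: "unit_mat R n p q x \<in> carrier (matrix_ring n R)" if "x \<in> carrier R" for p q x
    using that by (simp add: carrier_matrix_ring unit_mat_mem_matrices_over)
  \<comment> \<open>The product of the unit at \<open>(p, i)\<close>, \<open>A\<close> and the unit
    at \<open>(j, q)\<close> isolates the entry at \<open>(i, j)\<close> and puts it at
    \<open>(p, q)\<close>. If \<open>p\<close> or \<open>q\<close> is out of range, both sides are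
    the zero matrix.\<close>
  have entry: "unit_mat R n p q (A $$ (i, j)) \<in> J" if "A \<in> J" "i < n" "j < n" for A p q i j
  proof -
    let ?B = "unit_mat R n p i \<one> \<otimes>\<^bsub>matrix_ring n R\<^esub> A"
    have B: "?B \<in> J" using J.I_l_closed[OF that(1)] unit_M by simp
    have C: "?B \<otimes>\<^bsub>matrix_ring n R\<^esub> unit_mat R n j q \<one> \<in> J"
      using J.I_r_closed[OF B] unit_M by simp
    have "?B \<otimes>\<^bsub>matrix_ring n R\<^esub> unit_mat R n j q \<one> = unit_mat R n p q (A $$ (i, j))"
      unfolding mult_unit_mat[OF JM[OF B] one_closed that(3)]
      unfolding unit_mat_mult[OF JM[OF that(1)] one_closed that(2)]
      using that JM[OF that(1)] by (auto simp: unit_mat_def mem_matrices_over_iff intro!: eq_matI)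
    with C show ?thesis by simp
  qed
  \<comment> \<open>Through this equivalence the closure properties of \<open>I\<close> are read off
    from sums and products of corner matrices in \<open>J\<close>.\<close>
  have I_iff: "a \<in> I \<longleftrightarrow> unit_mat R n 0 0 a \<in> J" for a
  proof
    show "unit_mat R n 0 0 a \<in> J" if "a \<in> I"
      using that entry assms(2) by (auto simp: I_def)
    show "a \<in> I" if "unit_mat R n 0 0 a \<in> J"
      unfolding I_def using assms(2) by (intro image_eqI[OF _ that]) (simp add: unit_mat_def)
  qed
  have unit_J: "unit_mat R n p q a \<in> J" if "a \<in> I" for p q a
    using that entry assms(2) by (auto simp: I_def)
  have "ideal I R"
  proof (rule idealI_closed)
    show IR: "I \<subseteq> carrier R"
      using JM assms(2) by (auto simp: I_def mem_matrices_over_iff)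
    have "\<zero>\<^bsub>matrix_ring n R\<^esub> = unit_mat R n 0 0 \<zero>"
      by (auto simp: matrix_ring_def unit_mat_def)
    then show "\<zero> \<in> I"
      using J_zero by (simp add: I_iff)
    fix a assume a: "a \<in> I"
    then have E: "unit_mat R n 0 0 a \<in> J" by (simp add: I_iff)
    show "a \<oplus> b \<in> I" if "b \<in> I" for b
    proof -
      have "unit_mat R n 0 0 a \<oplus>\<^bsub>matrix_ring n R\<^esub> unit_mat R n 0 0 b = unit_mat R n 0 0 (a \<oplus> b)"
        by (auto simp: matrix_ring_def unit_mat_def intro!: eq_matI)
      then show ?thesis
        using that E by (metis I_iff J_add)
    qed
    fix x assume x: "x \<in> carrier R"
    have "unit_mat R n 0 0 x \<otimes>\<^bsub>matrix_ring n R\<^esub> unit_mat R n 0 0 a = unit_mat R n 0 0 (x \<otimes> a)"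
      using x JM[OF E] assms(2) by (subst unit_mat_mult) (auto simp: unit_mat_def intro!: eq_matI)
    then show "x \<otimes> a \<in> I"
      using J.I_l_closed[OF E unit_M[OF x, of 0 0]] by (simp add: I_iff)
    have "unit_mat R n 0 0 a \<otimes>\<^bsub>matrix_ring n R\<^esub> unit_mat R n 0 0 x = unit_mat R n 0 0 (a \<otimes> x)"
      using x JM[OF E] assms(2) by (subst mult_unit_mat) (auto simp: unit_mat_def intro!: eq_matI)
    then show "a \<otimes> x \<in> I"
      using J.I_r_closed[OF E unit_M[OF x, of 0 0]] by (simp add: I_iff)
  qed
  moreover have "J = matrices_over n I"
  proof
    show "J \<subseteq> matrices_over n I"
      using JM entry by (auto simp: I_iff mem_matrices_over_iff)
    show "matrices_over n I \<subseteq> J"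
    proof
      fix A assume A: "A \<in> matrices_over n I"
      have IR: "a \<in> carrier R" if "a \<in> I" for a
        using ideal.Icarr[OF \<open>ideal I R\<close> that] .
      \<comment> \<open>\<open>A\<close> is rebuilt one position at a time; \<open>S\<close> holds
        the positions already filled, and each step adds one scaled matrix unit from
        \<open>J\<close>.\<close>
      have "mat n n (\<lambda>p. if p \<in> S then A $$ p else \<zero>) \<in> J"
        if "finite S" "S \<subseteq> {..<n} \<times> {..<n}" for S
        using that
      proof (induction S rule: finite_induct)
        case empty
        have "mat n n (\<lambda>p. \<zero>) = \<zero>\<^bsub>matrix_ring n R\<^esub>"
          by (auto simp: matrix_ring_def)
        then show ?case using J_zero by simp
      next
        case (insert p S)
        obtain i j where p: "p = (i, j)" "i < n" "j < n" using insert.prems by auto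
        let ?B = "mat n n (\<lambda>p. if p \<in> S then A $$ p else \<zero>)"
        let ?E = "unit_mat R n i j (A $$ p)"
        have "?E \<in> J" using A p by (simp add: unit_J mem_matrices_over_iff)
        moreover have "?B \<in> J" using insert by simp
        ultimately have "?E \<oplus>\<^bsub>matrix_ring n R\<^esub> ?B \<in> J" by (rule J_add)
        moreover have "?E \<oplus>\<^bsub>matrix_ring n R\<^esub> ?B =
            mat n n (\<lambda>q. if q \<in> insert p S then A $$ q else \<zero>)"
          using A p insert.hyps IR
          by (auto simp: matrix_ring_def unit_mat_def mem_matrices_over_iff intro!: eq_matI)
        ultimately show ?case by simp
      qed
      from this[of "{..<n} \<times> {..<n}"]
      have "mat n n (\<lambda>p. if p \<in> {..<n} \<times> {..<n} then A $$ p else \<zero>) \<in> J" by simp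
      moreover have "mat n n (\<lambda>p. if p \<in> {..<n} \<times> {..<n} then A $$ p else \<zero>) = A"
        using A by (auto simp: mem_matrices_over_iff intro!: eq_matI)
      ultimately show "A \<in> J" by simp
    qed
  qed
  ultimately show thesis by (rule that)
qed

section \<open>Prime and minimal prime ideals of the matrix ring\<close>

lemma matrices_over_mult_closed_iff:
  assumes "ideal P R" "ideal A R" "ideal B R" "n \<ge> 1"
  shows "(\<forall>X\<in>matrices_over n A. \<forall>Y\<in>matrices_over n B.
      X \<otimes>\<^bsub>matrix_ring n R\<^esub> Y \<in> matrices_over n P) \<longleftrightarrow> (\<forall>a\<in>A. \<forall>b\<in>B. a \<otimes> b \<in> P)"
proof
  interpret A: ideal A R by fact
  interpret B: ideal B R by fact
  assume *: "\<forall>X\<in>matrices_over n A. \<forall>Y\<in>matrices_over n B.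
      X \<otimes>\<^bsub>matrix_ring n R\<^esub> Y \<in> matrices_over n P"
  show "\<forall>a\<in>A. \<forall>b\<in>B. a \<otimes> b \<in> P"
  proof (intro ballI)
    fix a b assume ab: "a \<in> A" "b \<in> B"
    \<comment> \<open>The product of these two corner matrices has \<open>a \<otimes> b\<close> as
      its entry at \<open>(0, 0)\<close>.\<close>
    let ?X = "unit_mat R n 0 0 a" and ?Y = "unit_mat R n 0 0 b"
    have "?X \<otimes>\<^bsub>matrix_ring n R\<^esub> ?Y \<in> matrices_over n P"
      using * ab by (simp add: unit_mat_mem_matrices_over)
    moreover have "?Y \<in> matrices_over n (carrier R)"
      using ab by (simp add: unit_mat_mem_matrices_over)
    ultimately have "mat n n (\<lambda>(i, j). if i = 0 then a \<otimes> ?Y $$ (0, j) else \<zero>) \<in> matrices_over n P"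
      using ab assms(4) by (simp add: unit_mat_mult)
    moreover have "0 < n" using assms(4) by simp
    ultimately have "a \<otimes> ?Y $$ (0, 0) \<in> P"
      unfolding mat_mem_matrices_over_iff by fastforce
    then show "a \<otimes> b \<in> P"
      using \<open>0 < n\<close> by (simp add: unit_mat_def)
  qed
next
  assume "\<forall>a\<in>A. \<forall>b\<in>B. a \<otimes> b \<in> P"
  \<comment> \<open>Every entry of the matrix product is a finite sum of elements
    \<open>a \<otimes> b\<close>, hence lies in \<open>P\<close>.\<close>
  then show "\<forall>X\<in>matrices_over n A. \<forall>Y\<in>matrices_over n B.
      X \<otimes>\<^bsub>matrix_ring n R\<^esub> Y \<in> matrices_over n P"
    by (auto simp: matrix_ring_def mat_mem_matrices_over_iff mem_matrices_over_iff
        intro!: finsum_mem_ideal[OF assms(1)])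
qed

text \<open>The test ideals in the definition of primeness correspond under
  \<open>matrices_over n\<close>, which preserves and reflects inclusions; properness transfers by
  its injectivity.\<close>

lemma nc_prime_ideal_matrices_over_iff:
  assumes "ideal P R" "n \<ge> 1"
  shows "nc_prime_ideal (matrices_over n P) (matrix_ring n R) \<longleftrightarrow> nc_prime_ideal P R"
proof -
  let ?M = "matrix_ring n R"
  interpret M: ring ?M by (rule ring_matrix_ring)
  \<comment> \<open>Both inclusions are reduced to products of elements, so the product ideal in the
    matrix ring never has to be determined.\<close>
  have iff: "ideal_prod ?M (matrices_over n A) (matrices_over n B) \<subseteq> matrices_over n P \<longleftrightarrow>
      ideal_prod R A B \<subseteq> P" if "ideal A R" "ideal B R" for A B
    using that assms ideal_matrices_over[OF assms(1)]
    by (simp add: M.ideal_prod_subset_iff ideal_prod_subset_iff matrices_over_mult_closed_iff)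
  have "(\<forall>A B. ideal A ?M \<and> ideal B ?M \<and> ideal_prod ?M A B \<subseteq> matrices_over n P \<longrightarrow>
        A \<subseteq> matrices_over n P \<or> B \<subseteq> matrices_over n P) \<longleftrightarrow>
      (\<forall>A B. ideal A R \<and> ideal B R \<and> ideal_prod R A B \<subseteq> P \<longrightarrow> A \<subseteq> P \<or> B \<subseteq> P)" (is "?L \<longleftrightarrow> ?R")
  proof
    assume ?L
    then show ?R
      by (metis iff ideal_matrices_over matrices_over_subset_iff[OF assms(2)])
  next
    assume ?R
    \<comment> \<open>Here arbitrary ideals of the matrix ring are given, and
      \<open>ideal_matrix_ringE\<close> replaces them by ideals of \<open>R\<close>.\<close>
    then show ?L
      by (metis iff ideal_matrix_ringE[OF _ assms(2)] matrices_over_subset_iff[OF assms(2)])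
  qed
  then show ?thesis
    using assms by (simp add: nc_prime_ideal_def ideal_matrices_over carrier_matrix_ring
        matrices_over_eq_iff)
qed

text \<open>A prime below \<open>matrices_over n P\<close> is itself of the form
  \<open>matrices_over n K\<close>, with \<open>K\<close> a prime below \<open>P\<close>, so
  minimality can be checked on either side.\<close>

lemma min_prime_ideal_matrices_over_iff:
  assumes "ideal P R" "n \<ge> 1"
  shows "min_prime_ideal (matrices_over n P) (matrix_ring n R) \<longleftrightarrow> min_prime_ideal P R"
proof -
  let ?M = "matrix_ring n R"
  have "(\<forall>Q. nc_prime_ideal Q ?M \<and> Q \<subseteq> matrices_over n P \<longrightarrow> Q = matrices_over n P) \<longleftrightarrow>
      (\<forall>Q. nc_prime_ideal Q R \<and> Q \<subseteq> P \<longrightarrow> Q = P)" (is "?L \<longleftrightarrow> ?R")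
  proof
    assume ?L
    then show ?R
      by (metis nc_prime_ideal_matrices_over_iff matrices_over_subset_iff matrices_over_eq_iff
          nc_prime_ideal_def assms(2))
  next
    assume R: ?R
    show ?L
    proof (intro allI impI)
      fix Q assume Q: "nc_prime_ideal Q ?M \<and> Q \<subseteq> matrices_over n P"
      then obtain K where "ideal K R" "Q = matrices_over n K"
        by (meson ideal_matrix_ringE[OF _ assms(2)] nc_prime_ideal_def)
      with Q have "nc_prime_ideal K R \<and> K \<subseteq> P"
        using assms(2) by (simp add: nc_prime_ideal_matrices_over_iff matrices_over_subset_iff)
      with R \<open>Q = _\<close> show "Q = matrices_over n P" by blast
    qed
  qed
  then show ?thesis
    using assms by (simp add: min_prime_ideal_def nc_prime_ideal_matrices_over_iff)
qed

section \<open>Hulls and the two kinds of z-ideals\<close>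

lemma min_prime_hull_matrix_ring:
  assumes "A \<in> carrier (matrix_ring n R)" "n \<ge> 1"
  shows "min_prime_hull (matrix_ring n R) {A} =
    matrices_over n (min_prime_hull R {A $$ (i, j) |i j. i < n \<and> j < n})"
proof -
  let ?F = "{A $$ (i, j) |i j. i < n \<and> j < n}"
  \<comment> \<open>This turns the condition that a minimal prime contains \<open>A\<close> into one
    on the set of entries of \<open>A\<close>.\<close>
  have A_iff: "A \<in> matrices_over n P \<longleftrightarrow> ?F \<subseteq> P" for P
    using assms(1) by (force simp: carrier_matrix_ring mem_matrices_over_iff)
  have primes: "{P. min_prime_ideal P (matrix_ring n R) \<and> {A} \<subseteq> P} =
      matrices_over n ` {P. min_prime_ideal P R \<and> ?F \<subseteq> P}" (is "?L = ?R")
  proof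
    show "?L \<subseteq> ?R"
    proof
      fix Q assume Q: "Q \<in> ?L"
      then have "ideal Q (matrix_ring n R)"
        by (simp add: min_prime_ideal_def nc_prime_ideal_def)
      then obtain P where P: "ideal P R" "Q = matrices_over n P"
        by (rule ideal_matrix_ringE[OF _ assms(2)])
      show "Q \<in> ?R"
        using Q P min_prime_ideal_matrices_over_iff[OF P(1) assms(2)] A_iff[of P] by blast
    qed
    show "?R \<subseteq> ?L"
    proof (rule image_subsetI)
      fix P assume P: "P \<in> {P. min_prime_ideal P R \<and> ?F \<subseteq> P}"
      then have "ideal P R" by (simp add: min_prime_ideal_def nc_prime_ideal_def)
      then show "matrices_over n P \<in> ?L"
        using P min_prime_ideal_matrices_over_iff[OF _ assms(2)] A_iff[of P] by blast
    qed
  qed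
  \<comment> \<open>Forming matrices commutes with intersections. The factor
    \<open>carrier R\<close> covers the empty family, where both sides are the whole matrix
    ring.\<close>
  show ?thesis
    unfolding min_prime_hull_def primes carrier_matrix_ring by (auto simp: mem_matrices_over_iff)
qed

text \<open>The bound \<open>n\<^sup>2\<close> is the number of positions: a matrix has at most that
  many distinct entries, and any set of at most that many elements fits into one matrix.\<close>

lemma z_circ_ideal_matrices_over_iff:
  assumes "ideal I R" "n \<ge> 1"
  shows "z_circ_ideal (matrices_over n I) (matrix_ring n R) \<longleftrightarrow> zm_circ_ideal (n\<^sup>2) I R"
proof -
  let ?entries = "\<lambda>A :: 'a mat. {A $$ (i, j) |i j. i < n \<and> j < n}"
  interpret I: ideal I R by fact
  have sub: "min_prime_hull (matrix_ring n R) {A} \<subseteq> matrices_over n I \<longleftrightarrow>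
      min_prime_hull R (?entries A) \<subseteq> I" if "A \<in> matrices_over n I" for A
    using that min_prime_hull_matrix_ring[OF _ assms(2), of A] matrices_over_subset_iff[OF assms(2)]
      ideal.Icarr[OF ideal_matrices_over[OF assms(1)]] by simp
  have "(\<forall>A\<in>matrices_over n I. min_prime_hull R (?entries A) \<subseteq> I) \<longleftrightarrow>
      (\<forall>F. finite F \<and> F \<subseteq> I \<and> card F \<le> n\<^sup>2 \<longrightarrow> min_prime_hull R F \<subseteq> I)" (is "?L \<longleftrightarrow> ?R")
  proof
    assume L: ?L
    show ?R
    proof (intro allI impI)
      fix F assume F: "finite F \<and> F \<subseteq> I \<and> card F \<le> n\<^sup>2"
      then have "card F \<le> card ({..<n} \<times> {..<n})"
        by (simp add: power2_eq_square)
      then obtain g where g: "g ` F \<subseteq> {..<n} \<times> {..<n}" "inj_on g F"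
        using card_le_inj[of F "{..<n} \<times> {..<n}"] F by auto
      define A where "A = mat n n (\<lambda>p. if p \<in> g ` F then inv_into F g p else \<zero>)"
      have "A \<in> matrices_over n I"
        using F by (auto simp: A_def mat_mem_matrices_over_iff inv_into_into subset_iff)
      with L have "min_prime_hull R (?entries A) \<subseteq> I" by blast
      moreover have "F \<subseteq> ?entries A"
      proof
        fix x assume x: "x \<in> F"
        obtain i j where ij: "g x = (i, j)" by fastforce
        with g(1) x have "i < n" "j < n" by auto
        moreover have "(i, j) \<in> g ` F" "inv_into F g (i, j) = x"
          using x ij inv_into_f_f[OF g(2) x] by (auto simp flip: ij)
        ultimately have "A $$ (i, j) = x" by (simp add: A_def)
        with \<open>i < n\<close> \<open>j < n\<close> show "x \<in> ?entries A" by blast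
      qed
      \<comment> \<open>The hull is monotone: fewer minimal primes contain the larger set.\<close>
      then have "min_prime_hull R F \<subseteq> min_prime_hull R (?entries A)"
        by (auto simp: min_prime_hull_def)
      ultimately show "min_prime_hull R F \<subseteq> I" by simp
    qed
  next
    assume R: ?R
    show ?L
    proof
      fix A assume A: "A \<in> matrices_over n I"
      \<comment> \<open>As an image of the set of positions, the set of entries is finite, and
        repeated entries only lower its size.\<close>
      have eq: "?entries A = (\<lambda>p. A $$ p) ` ({..<n} \<times> {..<n})" by force
      have "card (?entries A) \<le> n\<^sup>2"
        unfolding eq using card_image_le[of "{..<n} \<times> {..<n}" "\<lambda>p. A $$ p"]
        by (simp add: power2_eq_square)
      moreover have "finite (?entries A)" unfolding eq by simp
      moreover have "?entries A \<subseteq> I" using A by (auto simp: mem_matrices_over_iff)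
      ultimately show "min_prime_hull R (?entries A) \<subseteq> I" using R by blast
    qed
  qed
  then show ?thesis
    using sub assms by (simp add: z_circ_ideal_def zm_circ_ideal_def ideal_matrices_over)
qed

end

theorem theorem4p2:
  fixes R :: "('a, 'b) ring_scheme" and n :: nat and J :: "'a mat set"
  assumes "ring R" and "\<one>\<^bsub>R\<^esub> \<noteq> \<zero>\<^bsub>R\<^esub>"
    and "n \<ge> 1"
    and "ideal J (matrix_ring n R)"
  shows "z_circ_ideal J (matrix_ring n R) \<longleftrightarrow>
    (\<exists>I. zm_circ_ideal (n\<^sup>2) I R \<and> J = matrices_over n I)"
proof -
  interpret ring R by fact
  obtain I where I: "ideal I R" "J = matrices_over n I"
    using ideal_matrix_ringE[OF assms(4,3)] .
  \<comment> \<open>By injectivity of \<open>matrices_over n\<close>, this \<open>I\<close> is the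
    only possible witness for the existential.\<close>
  show ?thesis
    unfolding I(2) z_circ_ideal_matrices_over_iff[OF I(1) assms(3)] matrices_over_eq_iff[OF assms(3)]
    by auto
qed

end
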